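(* Let $d\ge 1$ and let $Y$ be a locally finite $d$-dimensional simplicial complex. For every continuous map $f \colon [0,1]^{d+1} \to \|Y\|$ there exist an index $i \in \{1,\dots,d+1\}$ and a point $y\in \|Y\|$ such that $f^{-1}(y) \cap S_{i,s} \neq \emptyset$ for every $s\in [0,1]$.
   Context: For a (locally finite) simplicial complex $Y$, $\|Y\|$ denotes its polyhedron: the underlying topological space, i.e. the union of its simplices with the topology induced by the geometric realization. For $s\in[0,1]$ and $i\in\{1,\dots,d+1\}$, $S_{i,s}=\{(x_1,\dots,x_{d+1})\in[0,1]^{d+1} : x_i=s\}$. *)

theory Defs
  imports "HOL-Analysis.Analysis"
begin

text \<open>Abstract simplicial complexes, as sets of nonempty finite simplices on an arbitrary,
  possibly infinite vertex type.\<close>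

definition abstract_complex :: "'v set set \<Rightarrow> bool" where
  "abstract_complex Y \<longleftrightarrow>
     (\<forall>\<sigma>\<in>Y. finite \<sigma> \<and> \<sigma> \<noteq> {}) \<and>
     (\<forall>\<sigma>\<in>Y. \<forall>\<tau>. \<tau> \<subseteq> \<sigma> \<longrightarrow> \<tau> \<noteq> {} \<longrightarrow> \<tau> \<in> Y)"

definition locally_finite_complex :: "'v set set \<Rightarrow> bool" where
  "locally_finite_complex Y \<longleftrightarrow> (\<forall>v\<in>\<Union>Y. finite {\<sigma>\<in>Y. v \<in> \<sigma>})"

definition complex_dimension :: "'v set set \<Rightarrow> nat \<Rightarrow> bool" where
  "complex_dimension Y d \<longleftrightarrow>
     (\<forall>\<sigma>\<in>Y. card \<sigma> \<le> d + 1) \<and> (\<exists>\<sigma>\<in>Y. card \<sigma> = d + 1)"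

text \<open>The closed geometric simplex spanned by \<open>\<sigma>\<close>, in barycentric coordinates.\<close>

definition geometric_simplex :: "'v set \<Rightarrow> ('v \<Rightarrow> real) set" where
  "geometric_simplex \<sigma> =
     {x. (\<forall>v. 0 \<le> x v) \<and> (\<forall>v. v \<notin> \<sigma> \<longrightarrow> x v = 0) \<and> (\<Sum>v\<in>\<sigma>. x v) = 1}"

text \<open>The polyhedron is the union of the geometric simplices with the weak (coherent) topology:
  a set is open iff its trace on every simplex is open there. The topology of the function type
  is the product topology, which on each geometric simplex is the Euclidean one.\<close>

definition polyhedron_of :: "'v set set \<Rightarrow> ('v \<Rightarrow> real) topology" where
  "polyhedron_of Y = topology (\<lambda>U. U \<subseteq> (\<Union>\<sigma>\<in>Y. geometric_simplex \<sigma>) \<and>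
     (\<forall>\<sigma>\<in>Y. openin (top_of_set (geometric_simplex \<sigma>)) (U \<inter> geometric_simplex \<sigma>)))"

lemma openin_polyhedron_of:
  "openin (polyhedron_of Y) U \<longleftrightarrow> U \<subseteq> (\<Union>\<sigma>\<in>Y. geometric_simplex \<sigma>) \<and>
     (\<forall>\<sigma>\<in>Y. openin (top_of_set (geometric_simplex \<sigma>)) (U \<inter> geometric_simplex \<sigma>))"
proof -
  have "istopology (\<lambda>U. U \<subseteq> (\<Union>\<sigma>\<in>Y. geometric_simplex \<sigma>) \<and>
     (\<forall>\<sigma>\<in>Y. openin (top_of_set (geometric_simplex \<sigma>)) (U \<inter> geometric_simplex \<sigma>)))"
    (is "istopology ?L")
    unfolding istopology_def
  proof (intro conjI allI impI)
    fix S T assume S: "?L S" and T: "?L T"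
    have "openin (top_of_set (geometric_simplex \<sigma>)) ((S \<inter> T) \<inter> geometric_simplex \<sigma>)"
      if "\<sigma> \<in> Y" for \<sigma>
    proof -
      have "openin (top_of_set (geometric_simplex \<sigma>))
              ((S \<inter> geometric_simplex \<sigma>) \<inter> (T \<inter> geometric_simplex \<sigma>))"
        by (rule openin_Int) (use S T that in blast)+
      moreover have "(S \<inter> geometric_simplex \<sigma>) \<inter> (T \<inter> geometric_simplex \<sigma>)
              = (S \<inter> T) \<inter> geometric_simplex \<sigma>" by blast
      ultimately show ?thesis by simp
    qed
    then show "\<forall>\<sigma>\<in>Y.
        openin (top_of_set (geometric_simplex \<sigma>)) ((S \<inter> T) \<inter> geometric_simplex \<sigma>)"
      by blast
    show "S \<inter> T \<subseteq> (\<Union>\<sigma>\<in>Y. geometric_simplex \<sigma>)"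
      using S by blast
  next
    fix \<K> assume K: "\<forall>S\<in>\<K>. ?L S"
    then show "\<Union>\<K> \<subseteq> (\<Union>\<sigma>\<in>Y. geometric_simplex \<sigma>)" by blast
    show "\<forall>\<sigma>\<in>Y. openin (top_of_set (geometric_simplex \<sigma>)) (\<Union>\<K> \<inter> geometric_simplex \<sigma>)"
    proof
      fix \<sigma> assume "\<sigma> \<in> Y"
      then have "openin (top_of_set (geometric_simplex \<sigma>)) (\<Union>S\<in>\<K>. S \<inter> geometric_simplex \<sigma>)"
        using K by (intro openin_Union) blast
      then show "openin (top_of_set (geometric_simplex \<sigma>)) (\<Union>\<K> \<inter> geometric_simplex \<sigma>)"
        by (simp only: Int_Union2)
    qed
  qed
  then show ?thesis
    unfolding polyhedron_of_def by (simp add: topology_inverse')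
qed

lemma topspace_polyhedron_of:
  "topspace (polyhedron_of Y) = (\<Union>\<sigma>\<in>Y. geometric_simplex \<sigma>)"
proof
  show "topspace (polyhedron_of Y) \<subseteq> (\<Union>\<sigma>\<in>Y. geometric_simplex \<sigma>)"
    using openin_polyhedron_of openin_topspace by blast
  have "(\<Union>\<sigma>\<in>Y. geometric_simplex \<sigma>) \<inter> geometric_simplex \<tau> = geometric_simplex \<tau>"
    if "\<tau> \<in> Y" for \<tau> using that by blast
  then have "openin (polyhedron_of Y) (\<Union>\<sigma>\<in>Y. geometric_simplex \<sigma>)"
    by (simp add: openin_polyhedron_of)
  then show "(\<Union>\<sigma>\<in>Y. geometric_simplex \<sigma>) \<subseteq> topspace (polyhedron_of Y)"
    by (rule openin_subset)
qed

definition unit_cube :: "(real ^ 'n) set" where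
  "unit_cube = {x. \<forall>i. x $ i \<in> {0..1}}"

definition cube_slice :: "'n \<Rightarrow> real \<Rightarrow> (real ^ 'n) set" where
  "cube_slice i s = {x \<in> unit_cube. x $ i = s}"

end

theory Submission
  imports Defs
begin

text \<open>Suppose every fibre misses, in each direction \<open>i\<close>, some slice \<open>x\<^sub>i = s\<close>; by compactness the
  same holds for the preimage of every sufficiently small set. Cut the barycentric coordinates by a
  fine cubical grid and sort the points by the number \<open>c\<close> of coordinates that are far from the
  grid. Thickened grid cells with the same \<open>c\<close> are open, small and pairwise disjoint. At most
  \<open>d + 1\<close> coordinates are nonzero and their sum is an integer multiple of the grid width, so
  \<open>c \<le> d + 1\<close> and \<open>c \<noteq> 1\<close>: this leaves \<open>d + 1\<close> classes, which are matched with the \<open>d + 1\<close>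
  directions of the cube. Splitting the preimage of each cell of the class matched with \<open>i\<close> along a
  slice \<open>x\<^sub>i = s\<close> that it misses covers the cube in a way that Brouwer's theorem forbids.\<close>

section \<open>Brouwer's theorem for pairs of open sets in the cube\<close>

lemma unit_cube_eq_cbox: "unit_cube = cbox (0 :: real ^ 'n) 1"
  by (auto simp: unit_cube_def mem_box_cart)

text \<open>Push \<open>x\<close> up in direction \<open>i\<close> on \<open>A i\<close> and down on
  \<open>B i\<close>, clamping to the cube. A Brouwer fixed point lies in some \<open>A i\<close> or
  \<open>B i\<close>, so only the face \<open>x $ i = 1\<close> or \<open>x $ i = 0\<close> could
  hold it in place, and \<open>A1\<close> and \<open>B0\<close> exclude these.\<close>

lemma cube_cover_contradiction:
  fixes A B :: "'n \<Rightarrow> (real ^ 'n) set"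
  assumes opA: "\<And>i. openin (top_of_set unit_cube) (A i)"
    and opB: "\<And>i. openin (top_of_set unit_cube) (B i)"
    and disj: "\<And>i. A i \<inter> B i = {}"
    and cover: "unit_cube \<subseteq> (\<Union>i. A i \<union> B i)"
    and A1: "\<And>i x. x \<in> A i \<Longrightarrow> x $ i \<noteq> 1"
    and B0: "\<And>i x. x \<in> B i \<Longrightarrow> x $ i \<noteq> 0"
  shows False
proof -
  define q :: "real ^ 'n" where "q = (\<chi> i. 2)"
  have q: "q \<notin> unit_cube"
    by (simp add: q_def unit_cube_def)
  \<comment> \<open>The far point \<open>q\<close> keeps the set nonempty, since \<open>infdist x {} = 0\<close>.\<close>
  define D where "D S x = infdist x (insert q (unit_cube - S))" for S and x :: "real ^ 'n"
  have cl: "closed (insert q (unit_cube - S))" if S: "openin (top_of_set unit_cube) S"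
    for S :: "(real ^ 'n) set"
  proof -
    obtain T where "open T" "S = unit_cube \<inter> T"
      using S by (auto simp: openin_open)
    then have "unit_cube - S = unit_cube - T"
      by blast
    then show ?thesis
      using \<open>open T\<close> closed_insert[OF closed_Diff[OF closed_cbox]]
      by (simp add: unit_cube_eq_cbox)
  qed
  have D_pos: "D S x > 0" if "openin (top_of_set unit_cube) S" "x \<in> S" for S x
  proof -
    have "x \<in> unit_cube"
      using that openin_imp_subset by blast
    then have "x \<notin> insert q (unit_cube - S)"
      using that q by blast
    then show ?thesis
      unfolding D_def using cl[OF that(1)] infdist_pos_not_in_closed by blast
  qed
  have D_0: "D S x = 0" if "x \<in> unit_cube" "x \<notin> S" for S x
    unfolding D_def using that by (intro infdist_zero) auto
  \<comment> \<open>\<open>h x i\<close> is positive on \<open>A i\<close> and negative on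
    \<open>B i\<close>: each term vanishes in the cube off its own set, and the two sets are
    disjoint.\<close>
  define h where "h x i = D (A i) x - D (B i) x" for x i
  define g where "g x = (\<chi> i. max 0 (min 1 (x $ i + h x i)))" for x :: "real ^ 'n"
  have "continuous_on (cbox 0 1) g"
    unfolding g_def h_def D_def by (intro continuous_intros)
  moreover have "g \<in> cbox 0 1 \<rightarrow> cbox 0 1"
    by (auto simp: g_def mem_box_cart)
  ultimately obtain x where x: "x \<in> cbox 0 1" "g x = x"
    using brouwer[of "cbox 0 1" g] by (auto simp: interval_ne_empty_cart)
  then have xc: "x \<in> unit_cube"
    by (simp add: unit_cube_eq_cbox)
  then obtain i where i: "x \<in> A i \<union> B i"
    using cover by blast
  have fixp: "max 0 (min 1 (x $ i + h x i)) = x $ i"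
    using x(2) unfolding g_def vec_eq_iff by simp
  show False
  proof (cases "x \<in> A i")
    case True
    then have "x \<notin> B i"
      using disj by blast
    then have "h x i > 0"
      using D_pos[OF opA True] D_0[OF xc] by (simp add: h_def)
    then show False
      using fixp A1[OF True] by (auto simp: max_def min_def split: if_splits)
  next
    case False
    then have B: "x \<in> B i"
      using i by blast
    then have "h x i < 0"
      using D_pos[OF opB B] D_0[OF xc False] by (simp add: h_def)
    then show False
      using fixp B0[OF B] by (auto simp: max_def min_def split: if_splits)
  qed
qed

section \<open>Compactness: from fibres to small sets\<close>

lemma continuous_map_polyhedron_coordinate:
  "continuous_map (polyhedron_of Y) euclideanreal (\<lambda>p. p v)"
proof (subst continuous_map_def, intro conjI allI impI)
  show "(\<lambda>p. p v) \<in> topspace (polyhedron_of Y) \<rightarrow> topspace euclideanreal"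
    by simp
next
  fix U :: "real set" assume "openin euclideanreal U"
  then have U: "open ((\<lambda>p. p v) -` U)"
    by (intro open_vimage) (auto simp: continuous_on_product_coordinates)
  have "{x \<in> topspace (polyhedron_of Y). x v \<in> U} \<inter> geometric_simplex \<sigma>
      = geometric_simplex \<sigma> \<inter> (\<lambda>p. p v) -` U" if "\<sigma> \<in> Y" for \<sigma>
    using that by (auto simp: topspace_polyhedron_of)
  then show "openin (polyhedron_of Y) {x \<in> topspace (polyhedron_of Y). x v \<in> U}"
    unfolding openin_polyhedron_of
    using U by (auto simp: topspace_polyhedron_of openin_open_Int)
qed

text \<open>If sets of shrinking diameter met every slice, points of two slices with images in the
  same sets would have limits in one fibre, and the second slice can be chosen as one that this
  fibre misses.\<close>

lemma small_preimage_misses_slice: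
  fixes f :: "real ^ 'n \<Rightarrow> 'v \<Rightarrow> real"
  assumes cont: "\<And>v. continuous_on unit_cube (\<lambda>x. f x v)"
    and miss: "\<And>y. \<exists>s\<in>{0..1}. f -` {y} \<inter> cube_slice i s = {}"
  shows "\<exists>e>0. \<forall>P. (\<forall>p\<in>P. \<forall>q\<in>P. \<forall>v. \<bar>p v - q v\<bar> < e) \<longrightarrow>
           (\<exists>s\<in>{0..1}. f -` P \<inter> cube_slice i s = {})"
proof (rule ccontr)
  assume neg: "\<not> ?thesis"
  have "\<exists>P. (\<forall>p\<in>P. \<forall>q\<in>P. \<forall>v. \<bar>p v - q v\<bar> < inverse (real (Suc m))) \<and>
           (\<forall>s\<in>{0..1}. f -` P \<inter> cube_slice i s \<noteq> {})" for m
    using neg by (metis inverse_positive_iff_positive of_nat_0_less_iff zero_less_Suc)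
  then obtain P where
    small: "\<And>m p q v. p \<in> P m \<Longrightarrow> q \<in> P m \<Longrightarrow> \<bar>p v - q v\<bar> < inverse (real (Suc m))" and
    "\<And>m s. s \<in> {0..1} \<Longrightarrow> f -` P m \<inter> cube_slice i s \<noteq> {}"
    by metis
  then have hit: "\<forall>m. \<exists>x. x \<in> cube_slice i s \<and> f x \<in> P m" if "s \<in> {0..1}" for s
    using that by blast
  have slice_compact: "compact (cube_slice i s)" for s
  proof -
    have "cube_slice i s = cbox 0 1 \<inter> {x. x $ i = s}"
      by (auto simp: cube_slice_def unit_cube_eq_cbox)
    moreover have "closed {x :: real ^ 'n. x $ i = s}"
      by (intro closed_Collect_eq continuous_intros)
    ultimately show ?thesis
      by (simp add: compact_Int_closed)
  qed
  have slice_sub: "cube_slice i s \<subseteq> unit_cube" for s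
    by (auto simp: cube_slice_def)
  \<comment> \<open>The slice at 0 is an arbitrary start: the limit \<open>x\<close> of its points
    fixes the fibre, and only then is \<open>s\<close> chosen.\<close>
  obtain X where X: "\<And>m. X m \<in> cube_slice i 0" "\<And>m. f (X m) \<in> P m"
    using choice[OF hit[of 0]] by auto
  obtain x r where x: "x \<in> cube_slice i 0" and r: "strict_mono r" "(X \<circ> r) \<longlonglongrightarrow> x"
    using slice_compact[of 0] X(1) unfolding compact_def by metis
  have lim: "(\<lambda>m. f (Z m) v) \<longlonglongrightarrow> f z v"
    if "\<And>m. Z m \<in> unit_cube" "z \<in> unit_cube" "Z \<longlonglongrightarrow> z" for Z z v
    using continuous_on_tendsto_compose[OF cont that(3,2)] that(1) by simp
  obtain s where s: "s \<in> {0..1}" "f -` {f x} \<inter> cube_slice i s = {}"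
    using miss by blast
  obtain W where "\<And>m. W m \<in> cube_slice i s" "\<And>m. f (W m) \<in> P m"
    using choice[OF hit[OF s(1)]] by blast
  \<comment> \<open>Reindexing by \<open>r\<close> places \<open>Z m\<close> and
    \<open>X (r m)\<close> over the same set \<open>P (r m)\<close>.\<close>
  moreover define Z where "Z m = W (r m)" for m
  ultimately have Z: "\<And>m. Z m \<in> cube_slice i s" "\<And>m. f (Z m) \<in> P (r m)"
    by auto
  obtain z k where z: "z \<in> cube_slice i s" and k: "strict_mono k" "(Z \<circ> k) \<longlonglongrightarrow> z"
    using slice_compact[of s] Z(1) unfolding compact_def by metis
  have "f z v = f x v" for v
  proof -
    have "(\<lambda>m. f ((Z \<circ> k) m) v) \<longlonglongrightarrow> f z v"
      by (rule lim[OF _ _ k(2)]) (use Z z slice_sub in auto)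
    moreover have "(\<lambda>m. f ((X \<circ> r \<circ> k) m) v) \<longlonglongrightarrow> f x v"
      by (rule lim[OF _ _ LIMSEQ_subseq_LIMSEQ[OF r(2) k(1)]]) (use X x slice_sub in auto)
    ultimately have "(\<lambda>m. f (Z (k m)) v - f (X (r (k m))) v) \<longlonglongrightarrow> f z v - f x v"
      by (auto intro: tendsto_diff)
    moreover have "(\<lambda>m. f (Z (k m)) v - f (X (r (k m))) v) \<longlonglongrightarrow> 0"
    proof (rule Lim_null_comparison)
      have "strict_mono (r \<circ> k)"
        using r(1) k(1) by (rule strict_mono_o)
      then show "(\<lambda>m. inverse (real (Suc ((r \<circ> k) m)))) \<longlonglongrightarrow> 0"
        using LIMSEQ_subseq_LIMSEQ[OF LIMSEQ_inverse_real_of_nat] by (simp add: o_def)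
      show "\<forall>\<^sub>F m in sequentially. norm (f (Z (k m)) v - f (X (r (k m))) v)
              \<le> inverse (real (Suc ((r \<circ> k) m)))"
        using small[OF Z(2) X(2)] by (auto intro!: always_eventually less_imp_le)
    qed
    ultimately show ?thesis
      using LIMSEQ_unique by fastforce
  qed
  then have "f z = f x"
    by (rule ext)
  then show False
    using s(2) z by blast
qed

section \<open>Thickened cells of the cubical grid\<close>

text \<open>A face of the grid of width \<open>1 / m\<close>: \<open>T\<close> holds the directions
  along which it extends, \<open>a\<close> is its lower corner in units of the width, and
  \<open>\<theta>\<close> trims the face along \<open>T\<close> and thickens it across.\<close>

definition grid_cell ::
  "'v set set \<Rightarrow> nat \<Rightarrow> real \<Rightarrow> 'v set \<Rightarrow> ('v \<Rightarrow> int) \<Rightarrow> ('v \<Rightarrow> real) set" where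
  "grid_cell Y m \<theta> T a = {p \<in> topspace (polyhedron_of Y).
     (\<forall>v\<in>T. of_int (a v) + \<theta> < m * p v \<and> m * p v < of_int (a v) + 1 - \<theta>) \<and>
     (\<forall>v. v \<notin> T \<longrightarrow> \<bar>m * p v - of_int (a v)\<bar> < \<theta>)}"

text \<open>On one simplex the coordinates outside \<open>\<sigma>\<close> are 0, so their possibly
  infinitely many conditions hold everywhere or fail everywhere; only finitely many open conditions
  remain.\<close>

lemma openin_grid_cell:
  assumes "abstract_complex Y"
  shows "openin (polyhedron_of Y) (grid_cell Y m \<theta> T a)"
  unfolding openin_polyhedron_of
proof (intro conjI ballI)
  show "grid_cell Y m \<theta> T a \<subseteq> (\<Union>\<sigma>\<in>Y. geometric_simplex \<sigma>)"
    by (auto simp: grid_cell_def topspace_polyhedron_of)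
next
  fix \<sigma> assume \<sigma>: "\<sigma> \<in> Y"
  then have fin: "finite \<sigma>"
    using assms by (auto simp: abstract_complex_def)
  define C where "C v = (if v \<in> T then {t :: real. of_int (a v) + \<theta> < m * t \<and> m * t < of_int (a v) + 1 - \<theta>}
    else {t :: real. \<bar>m * t - of_int (a v)\<bar> < \<theta>})" for v
  have "open (C v)" for v
    unfolding C_def by (cases "v \<in> T") (auto intro!: open_Collect_conj open_Collect_less continuous_intros)
  then have opn: "open (\<Inter>v\<in>\<sigma>. (\<lambda>p. p v) -` C v)"
    using fin by (intro open_INT ballI open_vimage) (auto simp: continuous_on_product_coordinates)
  have mem: "p \<in> grid_cell Y m \<theta> T a \<longleftrightarrow> (\<forall>v. p v \<in> C v)" if "p \<in> geometric_simplex \<sigma>" for p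
  proof -
    have "p \<in> topspace (polyhedron_of Y)"
      using that \<sigma> by (auto simp: topspace_polyhedron_of)
    then show ?thesis
      by (auto simp: grid_cell_def C_def)
  qed
  show "openin (top_of_set (geometric_simplex \<sigma>)) (grid_cell Y m \<theta> T a \<inter> geometric_simplex \<sigma>)"
  proof (cases "\<forall>v. v \<notin> \<sigma> \<longrightarrow> 0 \<in> C v")
    case True
    have "(\<forall>v. p v \<in> C v) \<longleftrightarrow> (\<forall>v\<in>\<sigma>. p v \<in> C v)" if "p \<in> geometric_simplex \<sigma>" for p
      using True that unfolding geometric_simplex_def by fastforce
    then have "grid_cell Y m \<theta> T a \<inter> geometric_simplex \<sigma> =
        geometric_simplex \<sigma> \<inter> (\<Inter>v\<in>\<sigma>. (\<lambda>p. p v) -` C v)"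
      using mem by auto
    then show ?thesis
      using opn by (simp add: openin_open_Int)
  next
    case False
    then obtain w where "w \<notin> \<sigma>" "0 \<notin> C w"
      by blast
    then have "p w \<notin> C w" if "p \<in> geometric_simplex \<sigma>" for p
      using that by (simp add: geometric_simplex_def)
    then have "grid_cell Y m \<theta> T a \<inter> geometric_simplex \<sigma> = {}"
      using mem by blast
    then show ?thesis
      by simp
  qed
qed

text \<open>With a common \<open>\<theta>\<close>, no coordinate is both in a trimmed interval and
  within \<open>\<theta>\<close> of an integer, which determines \<open>T\<close>; the entries of
  the two corners then differ by less than 1.\<close>

lemma grid_cell_disjoint:
  assumes \<theta>: "0 < \<theta>" "\<theta> < 1/2"
    and p: "p \<in> grid_cell Y m \<theta> T a" "p \<in> grid_cell Y m \<theta> T' a'"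
  shows "T = T'" "a = a'"
proof -
  have far: False if "p \<in> grid_cell Y m \<theta> T a" "p \<in> grid_cell Y m \<theta> T' a'" "v \<in> T" "v \<notin> T'"
    for v T T' a a'
  proof -
    have "of_int (a v) + \<theta> < m * p v" "m * p v < of_int (a v) + 1 - \<theta>"
      "\<bar>m * p v - of_int (a' v)\<bar> < \<theta>"
      using that by (auto simp: grid_cell_def)
    then have "a v < a' v" "a' v < a v + 1"
      by linarith+
    then show False
      by linarith
  qed
  show T: "T = T'"
    using far[OF p] far[OF p(2,1)] by blast
  show "a = a'"
  proof
    fix v
    have "\<bar>real_of_int (a v) - of_int (a' v)\<bar> < 1"
    proof (cases "v \<in> T")
      case True
      with p T have "of_int (a v) + \<theta> < m * p v" "m * p v < of_int (a v) + 1 - \<theta>"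
        "of_int (a' v) + \<theta> < m * p v" "m * p v < of_int (a' v) + 1 - \<theta>"
        by (auto simp: grid_cell_def)
      with \<theta> show ?thesis
        by linarith
    next
      case False
      with p T have "\<bar>m * p v - of_int (a v)\<bar> < \<theta>" "\<bar>m * p v - of_int (a' v)\<bar> < \<theta>"
        by (auto simp: grid_cell_def)
      with \<theta> show ?thesis
        by linarith
    qed
    then show "a v = a' v"
      by linarith
  qed
qed

lemma grid_cell_diameter:
  assumes "0 < \<theta>" "\<theta> < 1/2" "m > 0"
    and p: "p \<in> grid_cell Y m \<theta> T a" and q: "q \<in> grid_cell Y m \<theta> T a"
  shows "\<bar>p v - q v\<bar> < 1 / m"
proof -
  have "\<bar>m * p v - m * q v\<bar> < 1"
  proof (cases "v \<in> T")
    case True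
    with p q have "of_int (a v) + \<theta> < m * p v" "m * p v < of_int (a v) + 1 - \<theta>"
        "of_int (a v) + \<theta> < m * q v" "m * q v < of_int (a v) + 1 - \<theta>"
      by (auto simp: grid_cell_def)
    with assms(1) show ?thesis by linarith
  next
    case False
    with p q have "\<bar>m * p v - of_int (a v)\<bar> < \<theta>" "\<bar>m * q v - of_int (a v)\<bar> < \<theta>"
      by (auto simp: grid_cell_def)
    with assms(2) show ?thesis by linarith
  qed
  moreover have "\<bar>m * p v - m * q v\<bar> = m * \<bar>p v - q v\<bar>"
    by (simp add: abs_mult flip: right_diff_distrib)
  ultimately show ?thesis
    using assms(3) by (simp add: field_simps)
qed

text \<open>The thresholds decrease so fast that \<open>d\<close> deviations below \<open>grid_threshold d 1\<close> add up to less
  than \<open>grid_threshold d 0\<close>; this excludes exactly one coordinate being far from the grid.\<close>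

definition grid_threshold :: "nat \<Rightarrow> nat \<Rightarrow> real" where
  "grid_threshold d c = 1 / (4 * real (d + 2) ^ c)"

lemma grid_threshold_pos: "0 < grid_threshold d c"
  by (simp add: grid_threshold_def)

lemma grid_threshold_less_half: "grid_threshold d c < 1/2"
proof -
  have "1 \<le> real (d + 2) ^ c"
    by (rule one_le_power) simp
  then have "1 / (4 * real (d + 2) ^ c) \<le> 1 / (4 * 1)"
    by (intro divide_left_mono mult_left_mono) auto
  then show ?thesis
    unfolding grid_threshold_def by linarith
qed

lemma grid_threshold_Suc_less: "grid_threshold d (Suc c) < grid_threshold d c"
  by (simp add: grid_threshold_def divide_simps)

section \<open>Sorting points by the number of coordinates far from the grid\<close>

text \<open>Pigeonhole: as the threshold drops level by level, the number of far coordinates must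
  equal the level \<open>c\<close> at some point, since a simplex has at most \<open>d + 1\<close>
  vertices.\<close>

lemma grid_cells_cover:
  assumes dim: "complex_dimension Y d" and cplx: "abstract_complex Y"
    and p: "p \<in> topspace (polyhedron_of Y)"
  shows "\<exists>c \<in> {..d+1} - {1}. \<exists>T a. p \<in> grid_cell Y m (grid_threshold d c) T a"
proof -
  let ?t = "grid_threshold d"
  obtain \<sigma> where \<sigma>: "\<sigma> \<in> Y" and p\<sigma>: "p \<in> geometric_simplex \<sigma>"
    using p by (auto simp: topspace_polyhedron_of)
  have fin: "finite \<sigma>" and card\<sigma>: "card \<sigma> \<le> d + 1"
    using \<sigma> dim cplx by (auto simp: complex_dimension_def abstract_complex_def)
  have p0: "p v = 0" if "v \<notin> \<sigma>" for v
    using p\<sigma> that by (simp add: geometric_simplex_def)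
  have psum: "(\<Sum>v\<in>\<sigma>. p v) = 1"
    using p\<sigma> by (simp add: geometric_simplex_def)
  define \<delta> where "\<delta> v = \<bar>m * p v - of_int (round (m * p v))\<bar>" for v
  define F where "F c = {v\<in>\<sigma>. ?t c \<le> \<delta> v}" for c
  have finF: "finite (F c)" for c
    using fin by (simp add: F_def)
  define c where "c = (LEAST c. card (F c) \<le> c)"
  have "card (F (d + 1)) \<le> d + 1"
    using card_mono[OF fin, of "F (d + 1)"] card\<sigma> by (auto simp: F_def)
  then have c_le: "c \<le> d + 1" and Fc: "card (F c) \<le> c"
    unfolding c_def by (auto intro: Least_le LeastI)
  \<comment> \<open>Minimality gives \<open>card (F b) > b\<close>, so \<open>F b\<close> already
    has as many elements as \<open>F c\<close> can have: no deviation falls between the two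
    thresholds.\<close>
  have gap: "card (F c) = c \<and> F b = F c" if b: "c = Suc b" for b
  proof -
    have "\<not> card (F b) \<le> b"
      using not_less_Least[of b "\<lambda>c. card (F c) \<le> c"] b by (simp add: c_def)
    moreover have sub: "F b \<subseteq> F c"
      using grid_threshold_Suc_less[of d b] b by (auto simp: F_def)
    ultimately have "card (F b) = c" "card (F c) = c"
      using card_mono[OF finF sub] Fc b by auto
    then have "F b = F c"
      using card_subset_eq[OF finF sub] by simp
    then show ?thesis using \<open>card (F c) = c\<close> by simp
  qed
  have cardF: "card (F c) = c"
    using gap Fc by (cases c) auto
  \<comment> \<open>\<open>F\<close> is cut out by \<open>\<le>\<close> but cells are open; the gap
    up to the previous threshold supplies strictness.\<close>
  have far: "?t c < \<delta> v" if v: "v \<in> F c" for v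
  proof (cases c)
    case 0
    then show ?thesis
      using v cardF finF[of c] by auto
  next
    case (Suc b)
    then have "?t b \<le> \<delta> v"
      using gap v by (auto simp: F_def)
    then show ?thesis
      using grid_threshold_Suc_less[of d b] Suc by simp
  qed
  have "c \<noteq> 1"
  proof
    assume c1: "c = 1"
    then obtain w where w: "F 1 = {w}"
      using cardF card_1_singletonE by metis
    \<comment> \<open>As \<open>F 0 = F 1\<close>, the lone far coordinate deviates by at least
      \<open>?t 0\<close>. But all \<open>m * p v\<close> sum to the integer \<open>m\<close>, so
      \<open>m * p w\<close> is as near to an integer as the other deviations, each at most
      \<open>?t 1\<close>, allow in total.\<close>
    then have "w \<in> \<sigma>" and w0: "?t 0 \<le> \<delta> w"
      using gap[of 0] c1 by (auto simp: F_def)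
    let ?r = "\<lambda>v. round (m * p v)"
    have "real m = (\<Sum>v\<in>\<sigma>. m * p v)"
      using psum by (simp flip: sum_distrib_left)
    also have "\<dots> = m * p w + (\<Sum>v\<in>\<sigma> - {w}. m * p v)"
      using fin \<open>w \<in> \<sigma>\<close> by (rule sum.remove)
    finally have "m * p w - of_int (int m - (\<Sum>v\<in>\<sigma> - {w}. ?r v))
        = - (\<Sum>v\<in>\<sigma> - {w}. m * p v - of_int (?r v))"
      by (simp add: sum_subtractf)
    then have "\<bar>m * p w - of_int (int m - (\<Sum>v\<in>\<sigma> - {w}. ?r v))\<bar> \<le> (\<Sum>v\<in>\<sigma> - {w}. \<delta> v)"
      unfolding \<delta>_def by (simp only: abs_minus_cancel sum_abs)
    also have "\<dots> \<le> (\<Sum>v\<in>\<sigma> - {w}. ?t 1)"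
    proof (rule sum_mono)
      fix v assume "v \<in> \<sigma> - {w}"
      then have "v \<in> \<sigma>" "v \<notin> F 1"
        using w by auto
      then show "\<delta> v \<le> ?t 1"
        by (simp add: F_def)
    qed
    also have "\<dots> = (card \<sigma> - 1) * ?t 1"
      using fin \<open>w \<in> \<sigma>\<close> by simp
    also have "\<dots> \<le> d * ?t 1"
      using card\<sigma> grid_threshold_pos[of d 1] by (intro mult_right_mono) auto
    also have "\<dots> < ?t 0"
      by (simp add: grid_threshold_def divide_simps)
    \<comment> \<open>\<open>round\<close> yields a nearest integer, so closeness to any integer
      bounds \<open>\<delta> w\<close>.\<close>
    finally have "\<delta> w < ?t 0"
      using round_diff_minimal[of "m * p w" "int m - (\<Sum>v\<in>\<sigma> - {w}. ?r v)"]
      unfolding \<delta>_def by (simp add: abs_minus_commute)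
    with w0 show False
      by simp
  qed
  \<comment> \<open>A far coordinate lies above its lower corner, hence the floor. Vertices outside
    \<open>\<sigma>\<close> count as near, with \<open>a v = 0\<close>.\<close>
  moreover define a where "a v = (if v \<in> F c then \<lfloor>m * p v\<rfloor> else round (m * p v))" for v
  have "p \<in> grid_cell Y m (?t c) (F c) a"
    unfolding grid_cell_def
  proof (intro CollectI conjI ballI allI impI)
    show "p \<in> topspace (polyhedron_of Y)"
      by (fact p)
  next
    fix v assume v: "v \<in> F c"
    \<comment> \<open>\<open>\<delta> v\<close> is at most the distance to the floor and to the
      floor plus 1, which keeps the coordinate away from both ends.\<close>
    show "of_int (a v) + ?t c < m * p v"
      using far[OF v] round_diff_minimal[of "m * p v" "\<lfloor>m * p v\<rfloor>"] v
      unfolding \<delta>_def a_def by (simp, linarith?)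
    show "m * p v < of_int (a v) + 1 - ?t c"
      using far[OF v] round_diff_minimal[of "m * p v" "\<lfloor>m * p v\<rfloor> + 1"] v
      unfolding \<delta>_def a_def by (simp, linarith?)
  next
    fix v assume v: "v \<notin> F c"
    show "\<bar>m * p v - of_int (a v)\<bar> < ?t c"
    proof (cases "v \<in> \<sigma>")
      case True
      then show ?thesis
        using v by (auto simp: F_def \<delta>_def a_def)
    next
      case False
      then show ?thesis
        using v p0 grid_threshold_pos by (simp add: a_def)
    qed
  qed
  ultimately show ?thesis
    using c_le by blast
qed

section \<open>Matching the classes with the directions of the cube\<close>

theorem corollary6:
  fixes d :: nat
    and Y :: "'v set set"
    and f :: "real ^ 'n \<Rightarrow> 'v \<Rightarrow> real"
  assumes "d \<ge> 1"
    and "CARD('n) = d + 1"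
    and "abstract_complex Y"
    and "locally_finite_complex Y"
    and "complex_dimension Y d"
    and "continuous_map (top_of_set unit_cube) (polyhedron_of Y) f"
  shows "\<exists>i :: 'n. \<exists>y \<in> topspace (polyhedron_of Y).
           \<forall>s \<in> {0..1}. f -` {y} \<inter> cube_slice i s \<noteq> {}"
proof (rule ccontr)
  assume neg: "\<not> ?thesis"
  note contf = assms(6)
  have f_top: "f x \<in> topspace (polyhedron_of Y)" if "x \<in> unit_cube" for x
    using contf that by (auto simp: continuous_map_def)
  \<comment> \<open>A \<open>y\<close> outside the polyhedron has no preimage in the cube, so the
    slice at 0 serves.\<close>
  have miss: "\<exists>s\<in>{0..1}. f -` {y} \<inter> cube_slice i s = {}" for i y
  proof (cases "y \<in> topspace (polyhedron_of Y)")
    case True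
    then show ?thesis
      using neg by blast
  next
    case False
    then have "f -` {y} \<inter> cube_slice i 0 = {}"
      using f_top by (auto simp: cube_slice_def)
    then show ?thesis
      by force
  qed
  have contv: "continuous_on unit_cube (\<lambda>x. f x v)" for v
    using continuous_map_compose[OF contf continuous_map_polyhedron_coordinate[of Y v]]
    by (simp add: o_def)
  have "\<forall>i. \<exists>e>0. \<forall>P. (\<forall>p\<in>P. \<forall>q\<in>P. \<forall>v. \<bar>p v - q v\<bar> < e) \<longrightarrow>
           (\<exists>s\<in>{0..1}. f -` P \<inter> cube_slice i s = {})"
    using small_preimage_misses_slice[OF contv miss] by blast
  then obtain e where e: "\<And>i :: 'n. e i > 0"
    and slice: "\<And>i P. (\<And>p q v. p \<in> P \<Longrightarrow> q \<in> P \<Longrightarrow> \<bar>p v - q v\<bar> < e i) \<Longrightarrow>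
           \<exists>s\<in>{0..1}. f -` P \<inter> cube_slice i s = {}"
    by metis
  \<comment> \<open>There are finitely many directions, so one grid width suits them all.\<close>
  have "Min (range e) > 0"
    using e by simp
  then obtain m where m: "m > 0" "1 / real m < Min (range e)"
    by (metis inverse_eq_divide real_arch_inverse neq0_conv)
  then have me: "1 / real m < e i" for i
    by (simp add: order_less_le_trans)
  \<comment> \<open>Without the impossible class 1, the levels up to \<open>d + 1\<close> are
    \<open>d + 1 = CARD('n)\<close> in number.\<close>
  obtain \<gamma> :: "'n \<Rightarrow> nat" where \<gamma>: "bij_betw \<gamma> UNIV ({..d+1} - {1})"
    using finite_same_card_bij[of "UNIV :: 'n set" "{..d+1} - {1}"] assms(2) by auto
  let ?C = "\<lambda>i. grid_cell Y m (grid_threshold d (\<gamma> i))"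
  have "\<exists>s\<in>{0..1}. f -` ?C i T a \<inter> cube_slice i s = {}" for i T a
  proof (rule slice)
    fix p q v assume pq: "p \<in> ?C i T a" "q \<in> ?C i T a"
    have "\<bar>p v - q v\<bar> < 1 / m"
      by (rule grid_cell_diameter[OF grid_threshold_pos grid_threshold_less_half m(1) pq])
    then show "\<bar>p v - q v\<bar> < e i"
      using me[of i] by simp
  qed
  then obtain s where s01: "\<And>i T a. s i T a \<in> {0..1}"
    and s: "\<And>i T a. f -` ?C i T a \<inter> cube_slice i (s i T a) = {}"
    by metis
  \<comment> \<open>Each cell of the class of \<open>i\<close> is cut along its own missed
    slice.\<close>
  define A where "A i = (\<Union>T a. {x \<in> unit_cube. f x \<in> ?C i T a} \<inter> {x. x $ i < s i T a})" for i
  define B where "B i = (\<Union>T a. {x \<in> unit_cube. f x \<in> ?C i T a} \<inter> {x. s i T a < x $ i})" for i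
  have opn: "openin (top_of_set unit_cube) ({x \<in> unit_cube. f x \<in> ?C i T a} \<inter> S)"
    if "open S" for i T a S
  proof -
    have "openin (top_of_set unit_cube) {x \<in> unit_cube. f x \<in> ?C i T a}"
      using openin_continuous_map_preimage[OF contf openin_grid_cell[OF assms(3)]] by simp
    then show ?thesis
      using that by (metis openin_Int_open)
  qed
  show False
  proof (rule cube_cover_contradiction[of A B])
    fix i
    show "openin (top_of_set unit_cube) (A i)" "openin (top_of_set unit_cube) (B i)"
      unfolding A_def B_def
      by (auto intro!: openin_Union opn open_Collect_less continuous_on_const continuous_on_component continuous_on_id)
    show "A i \<inter> B i = {}"
    proof -
      have False if "x \<in> A i" "x \<in> B i" for x
      proof -
        from that obtain T a T' a' where "f x \<in> ?C i T a" "f x \<in> ?C i T' a'"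
          "x $ i < s i T a" "s i T' a' < x $ i"
          by (auto simp: A_def B_def)
        \<comment> \<open>Cells of one class are disjoint, so both cells coincide and share one cut
          value.\<close>
        then show False
          using grid_cell_disjoint[OF grid_threshold_pos grid_threshold_less_half, of "f x"] by fastforce
      qed
      then show ?thesis
        by blast
    qed
  next
    show "unit_cube \<subseteq> (\<Union>i. A i \<union> B i)"
    proof
      fix x :: "real ^ 'n" assume x: "x \<in> unit_cube"
      obtain c T a where c: "c \<in> {..d+1} - {1}" "f x \<in> grid_cell Y m (grid_threshold d c) T a"
        using grid_cells_cover[OF assms(5,3) f_top[OF x]] by blast
      then obtain i where "c = \<gamma> i"
        using \<gamma> by (metis bij_betw_imp_surj_on imageE)
      then have fx: "f x \<in> ?C i T a"
        using c by simp
      \<comment> \<open>The preimage of the cell avoids the cut slice, so no point is lost on the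
        cut.\<close>
      then have "x $ i \<noteq> s i T a"
        using s[of i T a] x by (auto simp: cube_slice_def)
      then have "x \<in> A i \<union> B i"
        unfolding A_def B_def using fx x by (auto simp: neq_iff)
      then show "x \<in> (\<Union>i. A i \<union> B i)"
        by blast
    qed
  next
    fix i x assume "x \<in> A i"
    then obtain T a where "x $ i < s i T a"
      by (auto simp: A_def)
    then show "x $ i \<noteq> 1"
      using s01[of i T a] by auto
  next
    fix i x assume "x \<in> B i"
    then obtain T a where "s i T a < x $ i"
      by (auto simp: B_def)
    then show "x $ i \<noteq> 0"
      using s01[of i T a] by auto
  qed
qed

end
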